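(* Let $\alpha,\beta>0$ with $\alpha\ne 1$, and let $N_t$ be the self-exciting point process with intensity $\lambda_t=\beta+\alpha\frac{N_{t-}}{t+1}$. (i) For all $t\ge 0$, $$\mathbb{E}[N_t]=(t+1)\frac{\beta}{1-\alpha}\left[1-(t+1)^{\alpha-1}\right].$$ Thus $\lim_{t\to\infty}\frac{\mathbb{E}[N_t]}{t}=\frac{\beta}{1-\alpha}$ if $\alpha<1$, and $\lim_{t\to\infty}\frac{\mathbb{E}[N_t]}{t^{\alpha}}=\frac{\beta}{\alpha-1}$ if $\alpha>1$. (ii) If $\alpha\neq\frac12$, then for all $t\ge 0$, $$\mathrm{Var}[N_t]=(t+1)^2\left[\frac{\frac{\beta}{(1-2\alpha)(1-\alpha)}}{t+1}+\frac{\frac{\beta}{1-\alpha}}{(t+1)^{2-\alpha}}+\frac{-\frac{2\beta}{1-2\alpha}}{(t+1)^{2(1-\alpha)}}\right].$$ For $0<\alpha<\frac12$, $\lim_{t\to\infty}\frac{\mathrm{Var}[N_t]}{t}=\frac{\beta}{(1-2\alpha)(1-\alpha)}$. For $\alpha>\frac12$ (with $\alpha\neq 1$), $\lim_{t\to\infty}\frac{\mathrm{Var}[N_t]}{t^{2\alpha}}=\frac{2\beta}{2\alpha-1}$.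
   Context: $N_t$ is a simple point process on $(0,\infty)$ with $N_0=0$ (empty past history) whose intensity at time $t$ with respect to its natural filtration is $\lambda_t=\lambda\left(\frac{N_{t-}}{t+1}\right)$ with $\lambda(z)=\beta+\alpha z$. *)

theory Defs
  imports "HOL-Probability.Probability"
begin

definition left_limit :: "(real \<Rightarrow> real) \<Rightarrow> real \<Rightarrow> real" where
  "left_limit f t = Lim (at_left t) f"

text \<open>
  A point process on the open half line of positive times is given by its counting process:
  \<open>N t \<omega>\<close> is the number of points in \<open>{0<..t}\<close>.  Values at nonpositive times are fixed to be
  zero (empty past), so that \<open>interval_measure (\<lambda>t. real (N t \<omega>))\<close> is the random counting
  measure itself.  Finiteness on bounded intervals (no explosion) is built into the type
  \<^typ>\<open>nat\<close>; simplicity is the last, almost sure, clause.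
\<close>

definition simple_point_process :: "'a measure \<Rightarrow> (real \<Rightarrow> 'a \<Rightarrow> nat) \<Rightarrow> bool" where
  "simple_point_process M N \<longleftrightarrow>
     (\<forall>t. N t \<in> measurable M (count_space UNIV)) \<and>
     (\<forall>\<omega>\<in>space M. (\<forall>t\<le>0. N t \<omega> = 0) \<and> mono (\<lambda>t. N t \<omega>) \<and>
        (\<forall>t. continuous (at_right t) (\<lambda>s. real (N s \<omega>)))) \<and>
     (AE \<omega> in M. \<forall>t>0. real (N t \<omega>) - left_limit (\<lambda>s. real (N s \<omega>)) t \<le> 1)"

definition natural_filtration ::
    "'a measure \<Rightarrow> (real \<Rightarrow> 'a \<Rightarrow> nat) \<Rightarrow> real \<Rightarrow> 'a measure" where
  "natural_filtration M N t =
     sigma (space M) {N s -` A \<inter> space M | s A. 0 \<le> s \<and> s \<le> t}"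

definition predictable_sigma :: "'a measure \<Rightarrow> (real \<Rightarrow> 'a measure) \<Rightarrow> (real \<times> 'a) measure" where
  "predictable_sigma M F =
     sigma ({0<..} \<times> space M) {{a<..b} \<times> A | a b A. 0 \<le> a \<and> a \<le> b \<and> A \<in> sets (F a)}"

definition progressively_measurable ::
    "(real \<Rightarrow> 'a measure) \<Rightarrow> (real \<Rightarrow> 'a \<Rightarrow> real) \<Rightarrow> bool" where
  "progressively_measurable F X \<longleftrightarrow>
     (\<forall>t\<ge>0. (\<lambda>(s, \<omega>). X s \<omega>) \<in> borel_measurable (restrict_space borel {0..t} \<Otimes>\<^sub>M F t))"

text \<open>
  Stochastic intensity in the sense of Bremaud: \<open>E (\<integral> C dN) = E (\<integral> C \<lambda> ds)\<close> for every nonnegative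
  predictable \<open>C\<close>.  Both sides take values in \<open>[0, \<infinity>]\<close>, so no moment of \<open>N\<close> is assumed finite.
  Requiring \<open>E (N b - N a | F a) = E (\<integral>\<^sub>a\<^sup>b \<lambda> ds | F a)\<close> only, with both sides
  allowed to be infinite, would be too weak: when they are infinite almost surely for all
  \<open>a < b\<close>, that identity does not determine the intensity.
\<close>

definition has_intensity ::
    "'a measure \<Rightarrow> (real \<Rightarrow> 'a measure) \<Rightarrow> (real \<Rightarrow> 'a \<Rightarrow> nat) \<Rightarrow> (real \<Rightarrow> 'a \<Rightarrow> real) \<Rightarrow> bool" where
  "has_intensity M F N lam \<longleftrightarrow>
     filtration (space M) F \<and>
     (\<forall>t\<ge>0. sets (F t) \<subseteq> sets M \<and> N t \<in> measurable (F t) (count_space UNIV)) \<and>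
     (\<forall>t\<ge>0. \<forall>\<omega>\<in>space M. 0 \<le> lam t \<omega>) \<and>
     progressively_measurable F lam \<and>
     (\<forall>t\<ge>0. AE \<omega> in M. (\<integral>\<^sup>+ s\<in>{0..t}. ennreal (lam s \<omega>) \<partial>lborel) < \<infinity>) \<and>
     (\<forall>C :: real \<times> 'a \<Rightarrow> ennreal. C \<in> borel_measurable (predictable_sigma M F) \<longrightarrow>
        (\<integral>\<^sup>+ \<omega>. (\<integral>\<^sup>+ s\<in>{0<..}. C (s, \<omega>) \<partial>interval_measure (\<lambda>t. real (N t \<omega>))) \<partial>M) =
        (\<integral>\<^sup>+ \<omega>. (\<integral>\<^sup>+ s\<in>{0<..}. C (s, \<omega>) * ennreal (lam s \<omega>) \<partial>lborel) \<partial>M))"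

end

theory Submission
  imports Defs "HOL-Real_Asymp.Real_Asymp"
begin

text \<open>
  Testing the intensity identity with the predictable integrand \<open>g (N\<^sub>s\<^sub>-)\<close> on \<open>{0<..t}\<close> gives,
  since all jumps have size one,
  \<open>E (\<Sum>k<N\<^sub>t. g k) = \<integral>\<^sub>0\<^sup>t E (g N\<^sub>s * (\<beta> + \<alpha> * N\<^sub>s / (s + 1))) ds\<close> for every \<open>g \<ge> 0\<close>.
  Taking \<open>g k = 2 * k + 1\<close> for \<open>k < n\<close> and \<open>0\<close> otherwise, so that the left side is
  \<open>E ((min N\<^sub>t n)\<^sup>2)\<close>, Gronwall's inequality bounds the second moment uniformly in \<open>n\<close>.  Then
  \<open>g = 1\<close> and \<open>g k = 2 * k + 1\<close> yield linear Volterra equations for the first two moments, which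
  have unique solutions.
\<close>

section \<open>Counting paths\<close>

text \<open>The intensity is characterised by an identity in [0, infinity], so finiteness of the
  moments has to be extracted from that identity itself. Gronwall's inequality can absorb only a
  function already known to be bounded; this forces the cutoff at n, which disappears again by
  monotone convergence. The weight g is the increment of the function whose expectation is wanted:
  2k + 1 = (k + 1)^2 - k^2, so the sum over k < N_t telescopes. Because the intensity is affine in
  N, the resulting equation for the first or second moment involves no higher moment, and the system
  closes. Integral equations are preferred to differential ones because, before they are solved,
  little more than monotonicity in time is known of the moments. The values \<alpha> = 1 and
  \<alpha> = 1/2 are resonances: there the homogeneous solution (t + 1)^\<alpha> of the mean
  equation, respectively (t + 1)^(2\<alpha>) of the variance equation, coincides with the linear
  term t + 1 of the closed form.\<close>

definition left_count :: "(real \<Rightarrow> nat) \<Rightarrow> real \<Rightarrow> nat" where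
  "left_count f s = nat \<lfloor>left_limit (\<lambda>r. real (f r)) s\<rfloor>"

text \<open>Before \<open>s\<close> the path takes only finitely many values, all at most
  \<open>f s\<close>. The largest is attained at some \<open>q < s\<close>, and monotonicity makes
  the path constant on the interval from \<open>q\<close> to \<open>s\<close>. Hence the left limit
  is a natural number and the rounding in \<open>left_count\<close> loses nothing.\<close>

lemma left_count_exists:
  fixes f :: "real \<Rightarrow> nat"
  assumes "mono f"
  shows "\<exists>L. left_limit (\<lambda>r. real (f r)) s = real L \<and> (\<forall>q<s. f q \<le> L) \<and> (\<exists>q<s. f q = L)"
proof -
  have fin: "finite (f ` {..<s})"
    by (rule finite_subset[of _ "{..f s}"]) (auto intro: monoD[OF assms])
  have ne: "f ` {..<s} \<noteq> {}"
    using lt_ex[of s] by auto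
  define L where "L = Max (f ` {..<s})"
  have ub: "\<forall>q<s. f q \<le> L"
    using fin unfolding L_def by auto
  obtain q where q: "q < s" "f q = L"
    using Max_in[OF fin ne] unfolding L_def by auto
  have "eventually (\<lambda>x. x \<in> {q<..<s}) (at_left s)"
    by (rule eventually_at_leftI[OF _ q(1)])
  then have "eventually (\<lambda>x. real (f x) = real L) (at_left s)"
  proof (rule eventually_mono)
    fix x assume "x \<in> {q<..<s}"
    then show "real (f x) = real L"
      using ub q monoD[OF assms, of q x] by (auto intro: antisym)
  qed
  then have "((\<lambda>r. real (f r)) \<longlongrightarrow> real L) (at_left s)"
    by (rule tendsto_eventually)
  then have "left_limit (\<lambda>r. real (f r)) s = real L"
    unfolding left_limit_def by (intro tendsto_Lim) auto
  then show ?thesis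
    using ub q by blast
qed

lemma
  fixes f :: "real \<Rightarrow> nat"
  assumes "mono f"
  shows left_limit_eq_left_count: "left_limit (\<lambda>r. real (f r)) s = real (left_count f s)"
    and le_left_count: "q < s \<Longrightarrow> f q \<le> left_count f s"
    and left_count_attained: "\<exists>q<s. f q = left_count f s"
  using left_count_exists[OF assms, of s] unfolding left_count_def by auto

lemma left_count_le:
  fixes f :: "real \<Rightarrow> nat"
  assumes "mono f" "s \<le> t"
  shows "left_count f s \<le> f t"
  using left_count_attained[OF assms(1), of s] monoD[OF assms(1)] assms(2)
  by (metis less_imp_le order.trans)

text \<open>Writes an event about the left limit as a countable union of events at strictly earlier
  rational times, which is what predictability asks for. Positivity of \<open>n\<close> forces
  \<open>q\<close> to be positive, as the path vanishes up to time 0.\<close>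

lemma left_count_pos_iff:
  fixes f :: "real \<Rightarrow> nat"
  assumes f: "mono f" "\<And>t. t \<le> 0 \<Longrightarrow> f t = 0" and n: "0 < n"
  shows "n \<le> left_count f s \<longleftrightarrow> (\<exists>q\<in>\<rat>. 0 \<le> q \<and> q < s \<and> n \<le> f q)"
proof
  assume "n \<le> left_count f s"
  then obtain q where q: "q < s" "n \<le> f q"
    using left_count_attained[OF f(1), of s] by auto
  then have "0 < q"
    using f(2)[of q] n by (cases "q \<le> 0") auto
  obtain r where "r \<in> \<rat>" "q < r" "r < s"
    using Rats_dense_in_real[OF q(1)] by blast
  then show "\<exists>q\<in>\<rat>. 0 \<le> q \<and> q < s \<and> n \<le> f q"
    using q \<open>0 < q\<close> monoD[OF f(1), of q r] by (intro bexI[of _ r]) auto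
next
  assume "\<exists>q\<in>\<rat>. 0 \<le> q \<and> q < s \<and> n \<le> f q"
  then show "n \<le> left_count f s"
    using le_left_count[OF f(1)] order.trans by blast
qed

lemma right_continuous_nat_stable:
  fixes f :: "real \<Rightarrow> nat"
  assumes "continuous (at_right t) (\<lambda>s. real (f s))"
  shows "\<exists>e>t. \<forall>s. t < s \<and> s < e \<longrightarrow> f s = f t"
proof -
  have "((\<lambda>s. real (f s)) \<longlongrightarrow> real (f t)) (at_right t)"
    using assms by (simp add: continuous_within)
  then have "eventually (\<lambda>s. dist (real (f s)) (real (f t)) < 1) (at_right t)"
    by (rule tendstoD) simp
  then have "eventually (\<lambda>s. f s = f t) (at_right t)"
    by eventually_elim (auto simp: dist_real_def)
  then show ?thesis
    unfolding eventually_at_right_field by blast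
qed

text \<open>The mirror image for the path itself, used for joint measurability in time and outcome:
  the path stays constant just after \<open>t\<close>, and that stretch contains a rational.\<close>

lemma less_iff_rat_right:
  fixes f :: "real \<Rightarrow> nat"
  assumes f: "mono f" and cont: "continuous (at_right t) (\<lambda>s. real (f s))"
  shows "f t < n \<longleftrightarrow> (\<exists>q\<in>\<rat>. t < q \<and> f q < n)"
proof
  assume "f t < n"
  obtain e where e: "e > t" "\<And>s. t < s \<Longrightarrow> s < e \<Longrightarrow> f s = f t"
    using right_continuous_nat_stable[OF cont] by blast
  obtain q where "q \<in> \<rat>" "t < q" "q < e"
    using Rats_dense_in_real[OF e(1)] by blast
  then show "\<exists>q\<in>\<rat>. t < q \<and> f q < n"
    using e(2) \<open>f t < n\<close> by auto
next
  assume "\<exists>q\<in>\<rat>. t < q \<and> f q < n"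
  then show "f t < n"
    using monoD[OF f] by (meson le_less_trans less_imp_le)
qed

text \<open>The set is an initial interval ending when the path reaches level \<open>n\<close>, or
  at \<open>t\<close> if that comes first. Unit jumps prevent the path from leaping over
  \<open>n\<close>, so its value at the endpoint is exactly \<open>min (f t) n\<close>.\<close>

lemma left_count_less_emeasure:
  fixes f :: "real \<Rightarrow> nat"
  assumes f: "mono f" "\<And>t. t \<le> 0 \<Longrightarrow> f t = 0"
    and cont: "\<And>t. continuous (at_right t) (\<lambda>s. real (f s))"
    and jump: "\<And>t. 0 < t \<Longrightarrow> f t \<le> left_count f t + 1"
    and t: "0 \<le> t"
  shows "{s. 0 < s \<and> s \<le> t \<and> left_count f s < n} \<in> sets borel" (is "?S \<in> _")
    and "emeasure (interval_measure (\<lambda>s. real (f s))) {s. 0 < s \<and> s \<le> t \<and> left_count f s < n} =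
           of_nat (min (f t) n)"
proof -
  have "\<exists>T. 0 \<le> T \<and> ?S = {0<..T} \<and> f T = min (f t) n"
  proof (cases "?S = {}")
    case True
    show ?thesis
    \<comment> \<open>These are the only ways to be empty: otherwise right continuity at 0 keeps the
      path at zero for a while, and those times belong to the set.\<close>
    proof (cases "t = 0 \<or> n = 0")
      case True
      then show ?thesis using f(2)[of 0] \<open>?S = {}\<close> by (intro exI[of _ 0]) auto
    next
      case False
      obtain e where e: "e > 0" "\<And>s. 0 < s \<Longrightarrow> s < e \<Longrightarrow> f s = f 0"
        using right_continuous_nat_stable[OF cont[of 0]] by blast
      define s where "s = min t (e/2)"
      have "0 < s" "s \<le> t" "s < e" using e False t by (auto simp: s_def)
      then have "left_count f s < n"
        using left_count_le[OF f(1), of s s] e(2)[of s] f(2)[of 0] False by auto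
      then show ?thesis using \<open>0 < s\<close> \<open>s \<le> t\<close> \<open>?S = {}\<close> by blast
    qed
  next
    case False
    define T where "T = Sup ?S"
    have bdd: "bdd_above ?S" by (rule bdd_aboveI[of _ t]) auto
    have le_T: "s \<le> T" if "s \<in> ?S" for s
      unfolding T_def using that bdd by (rule cSup_upper)
    have T_le: "T \<le> t"
      unfolding T_def by (rule cSup_least[OF False]) auto
    have "0 < T" using False le_T by fastforce
    have below: "s \<in> ?S" if s: "0 < s" "s < T" for s
    proof -
      obtain r where "r \<in> ?S" "s < r"
        using less_cSupD[OF False] s(2) unfolding T_def by blast
      moreover have "left_count f s \<le> left_count f r"
        using left_count_attained[OF f(1), of s] le_left_count[OF f(1), of _ r] \<open>s < r\<close>
        by (metis order.strict_trans)
      ultimately show ?thesis using s by auto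
    qed
    \<comment> \<open>The supremum is attained: the left count at \<open>T\<close> is the value at
      some \<open>q < T\<close>, hence already a lower bound for the left count at any
      \<open>s\<close> strictly between \<open>q\<close> and \<open>T\<close>.\<close>
    have "left_count f T < n"
    proof -
      obtain q where q: "q < T" "f q = left_count f T"
        using left_count_attained[OF f(1)] by blast
      obtain s where s: "max q 0 < s" "s < T"
        using dense[of "max q 0" T] q(1) \<open>0 < T\<close> by auto
      have "left_count f T \<le> left_count f s"
        using le_left_count[OF f(1), of q s] q s by auto
      then show ?thesis using below[of s] s by auto
    qed
    then have "T \<in> ?S" using \<open>0 < T\<close> T_le by auto
    then have S: "?S = {0<..T}" using below le_T by fastforce
    have fT: "f T \<le> n" using jump[OF \<open>0 < T\<close>] \<open>left_count f T < n\<close> by simp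
    have "f T = min (f t) n"
    proof (cases "T = t")
      case True
      then show ?thesis using fT by simp
    next
      case False
      have "n \<le> f T"
      proof (rule ccontr)
        assume "\<not> n \<le> f T"
        obtain e where e: "e > T" "\<And>s. T < s \<Longrightarrow> s < e \<Longrightarrow> f s = f T"
          using right_continuous_nat_stable[OF cont[of T]] by blast
        obtain s where s: "T < s" "s < min e t"
          using dense[of T "min e t"] e(1) False T_le by auto
        have "left_count f s < n"
          using left_count_le[OF f(1), of s s] e(2)[of s] s \<open>\<not> n \<le> f T\<close> by auto
        then have "s \<in> ?S" using s \<open>0 < T\<close> by auto
        then show False using le_T s by force
      qed
      then show ?thesis using fT monoD[OF f(1) T_le] by simp
    qed
    then show ?thesis using S \<open>0 < T\<close> by (intro exI[of _ T]) auto
  qed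
  then obtain T where T: "0 \<le> T" "?S = {0<..T}" "f T = min (f t) n" by blast
  show "?S \<in> sets borel" unfolding T(2) by simp
  have "emeasure (interval_measure (\<lambda>s. real (f s))) {0<..T} = ennreal (real (f T) - real (f 0))"
    using T(1) f(1) cont by (intro emeasure_interval_measure_Ioc) (auto simp: mono_def)
  then show "emeasure (interval_measure (\<lambda>s. real (f s))) ?S = of_nat (min (f t) n)"
    unfolding T(2) using T(3) f(2)[of 0] by (simp add: ennreal_of_nat_eq_real_of_nat)
qed

text \<open>A path with unit jumps leaves each level \<open>k < f t\<close> by exactly one jump in
  \<open>{0<..t}\<close>. So the times with left count \<open>k\<close> carry mass one for these
  \<open>k\<close> and mass zero for all others; the masses come from differences of consecutive
  sets in \<open>left_count_less_emeasure\<close>.\<close>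

lemma nn_integral_left_count:
  fixes f :: "real \<Rightarrow> nat" and g :: "nat \<Rightarrow> ennreal"
  assumes f: "mono f" "\<And>t. t \<le> 0 \<Longrightarrow> f t = 0"
    and cont: "\<And>t. continuous (at_right t) (\<lambda>s. real (f s))"
    and jump: "\<And>t. 0 < t \<Longrightarrow> f t \<le> left_count f t + 1"
    and t: "0 \<le> t"
  shows "(\<integral>\<^sup>+ s. indicator {0<..t} s * g (left_count f s) \<partial>interval_measure (\<lambda>s. real (f s))) =
           (\<Sum>k<f t. g k)"
proof -
  let ?I = "interval_measure (\<lambda>s. real (f s))"
  define S where "S n = {s. 0 < s \<and> s \<le> t \<and> left_count f s < n}" for n
  define A where "A n = {s. 0 < s \<and> s \<le> t \<and> left_count f s = n}" for n
  have S: "S n \<in> sets ?I" "emeasure ?I (S n) = of_nat (min (f t) n)" for n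
    using left_count_less_emeasure[OF assms] unfolding S_def by auto
  have A_eq: "A n = S (Suc n) - S n" for n
    unfolding A_def S_def by auto
  have A: "A n \<in> sets ?I" for n
    unfolding A_eq using S by blast
  have eA: "emeasure ?I (A n) = (if n < f t then 1 else 0)" for n
  proof -
    have "S n \<subseteq> S (Suc n)" unfolding S_def by auto
    then have "emeasure ?I (A n) = emeasure ?I (S (Suc n)) - emeasure ?I (S n)"
      unfolding A_eq using S by (intro emeasure_Diff) auto
    also have "\<dots> = of_nat (min (f t) (Suc n) - min (f t) n)"
      unfolding S(2) by (simp add: ennreal_of_nat_eq_real_of_nat flip: ennreal_minus)
    also have "\<dots> = (if n < f t then 1 else 0)" by auto
    finally show ?thesis .
  qed
  have "(\<integral>\<^sup>+ s. indicator {0<..t} s * g (left_count f s) \<partial>?I) =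
        (\<integral>\<^sup>+ s. (\<Sum>n. g n * indicator (A n) s) \<partial>?I)"
  proof (rule nn_integral_cong)
    fix s
    have "(\<Sum>n. g n * indicator (A n) s) = (\<Sum>n\<in>{left_count f s}. g n * indicator (A n) s)"
      by (rule suminf_finite) (auto simp: A_def indicator_def)
    then show "indicator {0<..t} s * g (left_count f s) = (\<Sum>n. g n * indicator (A n) s)"
      by (auto simp: A_def indicator_def)
  qed
  also have "\<dots> = (\<Sum>n. \<integral>\<^sup>+ s. g n * indicator (A n) s \<partial>?I)"
    using A by (intro nn_integral_suminf) auto
  also have "\<dots> = (\<Sum>n. if n < f t then g n else 0)"
    by (intro arg_cong[where f = suminf] ext) (auto simp: nn_integral_cmult_indicator[OF A] eA)
  also have "\<dots> = (\<Sum>n<f t. g n)"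
    by (subst suminf_finite[of "{..<f t}"]) auto
  finally show ?thesis .
qed

section \<open>Linear Volterra equations\<close>

text \<open>Weighting by \<open>exp (- 2 * K * s)\<close> makes the integral operator a contraction with factor
  one half, so a bounded \<open>w\<close> can be absorbed.\<close>

lemma gronwall_bounded:
  fixes w :: "real \<Rightarrow> real"
  assumes K: "0 < K" and c: "0 \<le> c"
    and bound: "\<And>s. s \<in> {0..T} \<Longrightarrow> w s \<le> B"
    and ineq: "\<And>t. t \<in> {0..T} \<Longrightarrow> \<exists>g. g integrable_on {0..t} \<and>
      (\<forall>s\<in>{0..t}. \<bar>g s\<bar> \<le> K * w s) \<and> w t \<le> c + integral {0..t} g"
    and t: "t \<in> {0..T}"
  shows "w t \<le> 2 * c * exp (2 * K * t)"
proof -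
  define A where "A = (SUP s\<in>{0..T}. w s * exp (- 2 * K * s))"
  have nonneg: "0 \<le> w s" if "s \<in> {0..T}" for s
  proof -
    obtain g where "\<forall>r\<in>{0..s}. \<bar>g r\<bar> \<le> K * w r"
      using ineq[OF \<open>s \<in> {0..T}\<close>] by blast
    then have "\<bar>g s\<bar> \<le> K * w s" using that by simp
    then have "0 \<le> K * w s" by linarith
    then show ?thesis using K by (simp add: zero_le_mult_iff)
  qed
  \<comment> \<open>The a priori bound \<open>B\<close> makes \<open>A\<close> a genuine supremum;
    its size does not enter the conclusion.\<close>
  have "bdd_above ((\<lambda>s. w s * exp (- 2 * K * s)) ` {0..T})"
  proof (rule bdd_aboveI2)
    fix s assume s: "s \<in> {0..T}"
    have "w s * exp (- 2 * K * s) \<le> w s * 1"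
      using K s nonneg[OF s] by (intro mult_left_mono) auto
    then show "w s * exp (- 2 * K * s) \<le> B" using bound[OF s] by simp
  qed
  then have upper: "w s * exp (- 2 * K * s) \<le> A" if "s \<in> {0..T}" for s
    unfolding A_def using that by (intro cSUP_upper)
  have le_A: "w s \<le> A * exp (2 * K * s)" if "s \<in> {0..T}" for s
    using upper[OF that] by (simp add: exp_minus field_simps)
  have A0: "0 \<le> A"
    using upper[OF t] nonneg[OF t] by (meson exp_ge_zero mult_nonneg_nonneg order.trans)
  have "w s * exp (- 2 * K * s) \<le> c + A / 2" if s: "s \<in> {0..T}" for s
  proof -
    obtain g where g: "g integrable_on {0..s}" "\<And>r. r \<in> {0..s} \<Longrightarrow> \<bar>g r\<bar> \<le> K * w r"
      "w s \<le> c + integral {0..s} g"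
      using ineq[OF s] by blast
    \<comment> \<open>The exponent has rate \<open>2 * K\<close> while the kernel has size
      \<open>K\<close>; their quotient is the factor one half.\<close>
    have "((\<lambda>r. K * A * exp (2 * K * r)) has_integral
        A / 2 * exp (2 * K * s) - A / 2 * exp (2 * K * 0)) {0..s}"
      using s K by (intro fundamental_theorem_of_calculus)
        (auto intro!: derivative_eq_intros simp flip: has_real_derivative_iff_has_vector_derivative)
    then have int: "((\<lambda>r. K * A * exp (2 * K * r)) has_integral A / 2 * exp (2 * K * s) - A / 2) {0..s}"
      by simp
    have "norm (integral {0..s} g) \<le> integral {0..s} (\<lambda>r. K * A * exp (2 * K * r))"
    proof (intro integral_norm_bound_integral g(1) has_integral_integrable[OF int])
      fix r assume r: "r \<in> {0..s}"
      then have "K * w r \<le> K * (A * exp (2 * K * r))"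
        using K s by (intro mult_left_mono le_A) auto
      then show "norm (g r) \<le> K * A * exp (2 * K * r)"
        using g(2)[OF r] by (simp add: mult.assoc)
    qed
    then have "w s \<le> c + A / 2 * exp (2 * K * s)"
      using g(3) A0 integral_unique[OF int] by simp
    also have "\<dots> \<le> (c + A / 2) * exp (2 * K * s)"
      using c K s by (simp add: distrib_right mult_le_cancel_left1)
    finally show ?thesis by (simp add: exp_minus field_simps)
  qed
  then have "A \<le> c + A / 2"
    unfolding A_def[symmetric] using t by (subst (1) A_def, intro cSUP_least) auto
  then have "A \<le> 2 * c" by simp
  then show ?thesis
    using le_A[OF t] by (meson exp_ge_zero mult_right_mono order.trans)
qed

text \<open>The difference of two solutions solves the homogeneous equation. Being an indefinite
  integral it is continuous, hence bounded on \<open>{0..T}\<close>, and Gronwall with constant 0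
  makes it vanish.\<close>

lemma linear_volterra_unique:
  fixes f h b :: "real \<Rightarrow> real"
  assumes f: "\<And>t. 0 \<le> t \<Longrightarrow> ((\<lambda>s. b s + a * (f s / (s + 1))) has_integral f t) {0..t}"
    and h: "\<And>t. 0 \<le> t \<Longrightarrow> ((\<lambda>s. b s + a * (h s / (s + 1))) has_integral h t) {0..t}"
    and T: "0 \<le> T"
  shows "f T = h T"
proof -
  define d where "d s = f s - h s" for s
  \<comment> \<open>The factor \<open>1 / (s + 1)\<close> is at most 1, and the added 1 keeps
    \<open>K\<close> positive when \<open>a = 0\<close>.\<close>
  define K where "K = \<bar>a\<bar> + 1"
  have d: "((\<lambda>s. a * (d s / (s + 1))) has_integral d t) {0..t}" if "0 \<le> t" for t
    using has_integral_diff[OF f[OF that] h[OF that]]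
    by (simp add: d_def diff_divide_distrib right_diff_distrib)
  have "continuous_on {0..T} (\<lambda>t. integral {0..t} (\<lambda>s. a * (d s / (s + 1))))"
    using d[OF T] by (intro indefinite_integral_continuous_1) auto
  then have "continuous_on {0..T} d"
    by (rule continuous_on_eq) (rule integral_unique, rule d, simp)
  then have "bounded (d ` {0..T})"
    by (intro compact_imp_bounded compact_continuous_image) auto
  then obtain B where B: "\<And>s. s \<in> {0..T} \<Longrightarrow> \<bar>d s\<bar> \<le> B"
    unfolding bounded_iff by (force simp del: atLeastAtMost_iff)
  have "\<bar>d T\<bar> \<le> 2 * 0 * exp (2 * K * T)"
  proof (rule gronwall_bounded[where T = T and w = "\<lambda>s. \<bar>d s\<bar>" and K = K and B = B])
    fix t assume t: "t \<in> {0..T}"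
    \<comment> \<open>With \<open>t\<close> fixed, this constant sign turns the integral equation
      for \<open>d t\<close> into one for its absolute value.\<close>
    define g where "g s = sgn (d t) * (a * (d s / (s + 1)))" for s
    have g: "(g has_integral sgn (d t) * d t) {0..t}"
      unfolding g_def using t by (intro has_integral_mult_right d) auto
    have "\<bar>g s\<bar> \<le> K * \<bar>d s\<bar>" if "s \<in> {0..t}" for s
    proof -
      have "\<bar>g s\<bar> \<le> \<bar>a\<bar> * (\<bar>d s\<bar> / \<bar>s + 1\<bar>)"
        by (auto simp: g_def abs_mult sgn_if)
      also have "\<bar>d s\<bar> / \<bar>s + 1\<bar> \<le> \<bar>d s\<bar> / 1"
        using that by (intro divide_left_mono) auto
      also have "\<bar>a\<bar> * (\<bar>d s\<bar> / 1) \<le> K * \<bar>d s\<bar>"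
        unfolding K_def by (simp add: distrib_right)
      finally show ?thesis by (simp add: mult_left_mono)
    qed
    then show "\<exists>g. g integrable_on {0..t} \<and> (\<forall>s\<in>{0..t}. \<bar>g s\<bar> \<le> K * \<bar>d s\<bar>) \<and>
        \<bar>d t\<bar> \<le> 0 + integral {0..t} g"
      using g by (intro exI[of _ g]) (auto simp: integral_unique sgn_if)
  qed (use B T in \<open>auto simp: K_def\<close>)
  then show ?thesis by (simp add: d_def)
qed

lemma has_integral_of_nn_integral:
  fixes h :: "real \<Rightarrow> real"
  assumes "h integrable_on S" "\<And>s. s \<in> S \<Longrightarrow> 0 \<le> h s" "0 \<le> I"
    and "ennreal I = (\<integral>\<^sup>+ s. indicator S s * ennreal (h s) \<partial>lborel)"
  shows "(h has_integral I) S"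
proof -
  have "ennreal I = ennreal (integral S h)"
    using nn_integral_has_integral_lebesgue'[OF assms(2) integrable_integral[OF assms(1)]] assms(4)
    by (simp add: mult.commute)
  then have "I = integral S h"
    using assms(2,3) integral_nonneg[OF assms(1,2)] by simp
  then show ?thesis using assms(1) by (simp add: has_integral_integral)
qed

text \<open>The quotient of a monotone function by \<open>s + 1\<close> need not be monotone, so
  integrability comes from Borel measurability of \<open>m\<close> together with the bound
  \<open>m t\<close>.\<close>

lemma mono_divide_integrable_on:
  fixes m :: "real \<Rightarrow> real"
  assumes "mono m" "\<And>s. 0 \<le> m s"
  shows "(\<lambda>s. m s / (s + 1)) integrable_on {0..t}"
proof -
  have [measurable]: "m \<in> borel_measurable borel"
    using assms(1) by (rule borel_measurable_mono)
  have "norm (m s / (s + 1)) \<le> m t" if "s \<in> {0..t}" for s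
  proof -
    have "norm (m s / (s + 1)) \<le> m s / 1"
      using that assms(2)[of s] divide_left_mono[of 1 "s + 1" "m s"] by simp
    also have "\<dots> \<le> m t" using that monoD[OF assms(1)] by simp
    finally show ?thesis .
  qed
  then have "set_integrable lborel {0..t} (\<lambda>s. m s / (s + 1))"
    unfolding set_integrable_def
    by (intro integrableI_bounded_set_indicator[where B = "m t"]) (auto simp: emeasure_lborel_Icc_eq)
  then show ?thesis by (rule set_borel_integral_eq_integral(1))
qed

section \<open>Closed forms and the equations they solve\<close>

definition mean_fn :: "real \<Rightarrow> real \<Rightarrow> real \<Rightarrow> real" where
  "mean_fn \<alpha> \<beta> t = \<beta> / (1 - \<alpha>) * ((t + 1) - (t + 1) powr \<alpha>)"

definition var_fn :: "real \<Rightarrow> real \<Rightarrow> real \<Rightarrow> real" where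
  "var_fn \<alpha> \<beta> t = \<beta> / ((1 - 2 * \<alpha>) * (1 - \<alpha>)) * (t + 1) + \<beta> / (1 - \<alpha>) * (t + 1) powr \<alpha>
     - 2 * \<beta> / (1 - 2 * \<alpha>) * (t + 1) powr (2 * \<alpha>)"

lemma has_derivative_mean_fn:
  assumes "\<alpha> \<noteq> 1" "0 \<le> t"
  shows "(mean_fn \<alpha> \<beta> has_real_derivative \<beta> + \<alpha> * (mean_fn \<alpha> \<beta> t / (t + 1))) (at t within S)"
proof -
  have p: "(t + 1) powr (\<alpha> - 1) = (t + 1) powr \<alpha> / (t + 1)"
    using assms by (simp add: powr_diff)
  have "(mean_fn \<alpha> \<beta> has_real_derivative \<beta> / (1 - \<alpha>) * (1 - \<alpha> * (t + 1) powr (\<alpha> - 1))) (at t within S)"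
    unfolding mean_fn_def[abs_def] using assms by (auto intro!: derivative_eq_intros)
  also have "\<beta> / (1 - \<alpha>) * (1 - \<alpha> * (t + 1) powr (\<alpha> - 1)) =
      \<beta> + \<alpha> * (mean_fn \<alpha> \<beta> t / (t + 1))"
    unfolding p mean_fn_def using assms by (simp add: divide_simps) (simp add: algebra_simps)
  finally show ?thesis .
qed

text \<open>The right side is the expected intensity plus twice the covariance of the count with its
  intensity; that covariance is \<alpha> / (t + 1) times the variance.\<close>

lemma has_derivative_var_fn:
  assumes "\<alpha> \<noteq> 1" "\<alpha> \<noteq> 1 / 2" "0 \<le> t"
  shows "(var_fn \<alpha> \<beta> has_real_derivative
    \<beta> + \<alpha> * (mean_fn \<alpha> \<beta> t / (t + 1)) + 2 * \<alpha> * (var_fn \<alpha> \<beta> t / (t + 1))) (at t within S)"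
proof -
  have p: "(t + 1) powr (\<alpha> - 1) = (t + 1) powr \<alpha> / (t + 1)"
    "(t + 1) powr (2 * \<alpha> - 1) = (t + 1) powr (2 * \<alpha>) / (t + 1)"
    using assms by (simp_all add: powr_diff)
  have "(var_fn \<alpha> \<beta> has_real_derivative
      \<beta> / ((1 - 2 * \<alpha>) * (1 - \<alpha>)) + \<beta> / (1 - \<alpha>) * (\<alpha> * (t + 1) powr (\<alpha> - 1))
       - 2 * \<beta> / (1 - 2 * \<alpha>) * (2 * \<alpha> * (t + 1) powr (2 * \<alpha> - 1))) (at t within S)"
    unfolding var_fn_def[abs_def] using assms by (auto intro!: derivative_eq_intros simp: mult_ac)
  also have "\<beta> / ((1 - 2 * \<alpha>) * (1 - \<alpha>)) + \<beta> / (1 - \<alpha>) * (\<alpha> * (t + 1) powr (\<alpha> - 1))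
       - 2 * \<beta> / (1 - 2 * \<alpha>) * (2 * \<alpha> * (t + 1) powr (2 * \<alpha> - 1)) =
      \<beta> + \<alpha> * (mean_fn \<alpha> \<beta> t / (t + 1)) + 2 * \<alpha> * (var_fn \<alpha> \<beta> t / (t + 1))"
  proof -
    \<comment> \<open>Naming the denominators leaves a polynomial identity modulo two linear
      relations.\<close>
    define x y where "x = 1 - \<alpha>" and "y = 1 - 2 * \<alpha>"
    have nz: "x \<noteq> 0" "y \<noteq> 0" "t + 1 \<noteq> 0" and a: "\<alpha> = x - y" "2 * x = y + 1"
      using assms by (auto simp: x_def y_def)
    show ?thesis
      unfolding p mean_fn_def var_fn_def x_def[symmetric] y_def[symmetric]
      using nz by (simp add: divide_simps) (use a in algebra)
  qed
  finally show ?thesis .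
qed

lemma mean_fn_integral_equation:
  assumes "\<alpha> \<noteq> 1" "0 \<le> t"
  shows "((\<lambda>s. \<beta> + \<alpha> * (mean_fn \<alpha> \<beta> s / (s + 1))) has_integral mean_fn \<alpha> \<beta> t) {0..t}"
proof -
  have "((\<lambda>s. \<beta> + \<alpha> * (mean_fn \<alpha> \<beta> s / (s + 1))) has_integral
      mean_fn \<alpha> \<beta> t - mean_fn \<alpha> \<beta> 0) {0..t}"
    using assms has_derivative_mean_fn[OF assms(1)]
    by (intro fundamental_theorem_of_calculus)
      (auto simp flip: has_real_derivative_iff_has_vector_derivative)
  then show ?thesis by (simp add: mean_fn_def)
qed

text \<open>The derivative of the squared mean contributes \<open>2 * \<alpha> * (mean_fn \<alpha>
  \<beta> s)\<^sup>2 / (s + 1)\<close>, which completes the variance term to one in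
  \<open>q\<close>, and the forcing \<open>2 * \<beta> * mean_fn \<alpha> \<beta> s\<close>.\<close>

lemma second_moment_integral_equation:
  fixes \<alpha> \<beta> :: real
  assumes "\<alpha> \<noteq> 1" "\<alpha> \<noteq> 1 / 2" "0 \<le> t"
  defines "q \<equiv> \<lambda>s. var_fn \<alpha> \<beta> s + (mean_fn \<alpha> \<beta> s)\<^sup>2"
  shows "((\<lambda>s. \<beta> + 2 * \<beta> * mean_fn \<alpha> \<beta> s + \<alpha> * (mean_fn \<alpha> \<beta> s / (s + 1)) + 2 * \<alpha> * (q s / (s + 1)))
    has_integral q t) {0..t}"
proof -
  have "((\<lambda>s. \<beta> + 2 * \<beta> * mean_fn \<alpha> \<beta> s + \<alpha> * (mean_fn \<alpha> \<beta> s / (s + 1)) + 2 * \<alpha> * (q s / (s + 1)))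
    has_integral q t - q 0) {0..t}"
  proof (intro fundamental_theorem_of_calculus)
    fix s assume s: "s \<in> {0..t}"
    show "(q has_vector_derivative \<beta> + 2 * \<beta> * mean_fn \<alpha> \<beta> s + \<alpha> * (mean_fn \<alpha> \<beta> s / (s + 1)) +
        2 * \<alpha> * (q s / (s + 1))) (at s within {0..t})"
      unfolding q_def has_real_derivative_iff_has_vector_derivative[symmetric]
      using s assms(1,2)
      by (auto intro!: derivative_eq_intros has_derivative_mean_fn has_derivative_var_fn)
        (simp add: algebra_simps power2_eq_square add_divide_distrib)
  qed fact
  \<comment> \<open>At time 0 all powers are 1 and the three coefficients of \<open>var_fn\<close>
    sum to zero.\<close>
  moreover have "q 0 = 0"
    unfolding q_def using assms(1,2)
    by (simp add: mean_fn_def var_fn_def divide_simps) (simp add: algebra_simps)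
  ultimately show ?thesis by simp
qed

section \<open>Growth of the closed forms\<close>

lemma mean_fn_tendsto:
  "\<alpha> < 1 \<Longrightarrow> ((\<lambda>t. mean_fn \<alpha> \<beta> t / t) \<longlongrightarrow> \<beta> / (1 - \<alpha>)) at_top"
  "1 < \<alpha> \<Longrightarrow> ((\<lambda>t. mean_fn \<alpha> \<beta> t / t powr \<alpha>) \<longlongrightarrow> \<beta> / (\<alpha> - 1)) at_top"
proof -
  assume "\<alpha> < 1"
  have "((\<lambda>t::real. ((t + 1) - (t + 1) powr \<alpha>) / t) \<longlongrightarrow> 1) at_top"
    using \<open>\<alpha> < 1\<close> by real_asymp
  then show "((\<lambda>t. mean_fn \<alpha> \<beta> t / t) \<longlongrightarrow> \<beta> / (1 - \<alpha>)) at_top"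
    using tendsto_mult_left[of _ 1 _ "\<beta> / (1 - \<alpha>)"] by (fastforce simp: mean_fn_def)
next
  assume "1 < \<alpha>"
  have "((\<lambda>t::real. ((t + 1) - (t + 1) powr \<alpha>) / t powr \<alpha>) \<longlongrightarrow> - 1) at_top"
    using \<open>1 < \<alpha>\<close> by real_asymp
  then have "((\<lambda>t. mean_fn \<alpha> \<beta> t / t powr \<alpha>) \<longlongrightarrow> \<beta> / (1 - \<alpha>) * - 1) at_top"
    using tendsto_mult_left[of _ "-1" _ "\<beta> / (1 - \<alpha>)"] by (fastforce simp: mean_fn_def)
  also have "\<beta> / (1 - \<alpha>) * - 1 = \<beta> / (\<alpha> - 1)" using \<open>1 < \<alpha>\<close> by (simp add: divide_simps) (simp add: algebra_simps)
  finally show "((\<lambda>t. mean_fn \<alpha> \<beta> t / t powr \<alpha>) \<longlongrightarrow> \<beta> / (\<alpha> - 1)) at_top" .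
qed

text \<open>Lets each power be compared with the normalisation separately, keeping the coefficients
  out of the asymptotics.\<close>

lemma divide_lincomb: "(a * x + b * y - c * z) / u = a * (x / u) + b * (y / u) - c * (z / u)"
  for a b c x y z u :: real
  by (simp add: add_divide_distrib diff_divide_distrib)

lemma var_fn_tendsto_subcritical:
  assumes a: "0 < \<alpha>" "\<alpha> < 1 / 2"
  shows "((\<lambda>t. var_fn \<alpha> \<beta> t / t) \<longlongrightarrow> \<beta> / ((1 - 2 * \<alpha>) * (1 - \<alpha>))) at_top"
proof -
  have "((\<lambda>t::real. (t + 1) / t) \<longlongrightarrow> 1) at_top"
    "((\<lambda>t::real. (t + 1) powr \<alpha> / t) \<longlongrightarrow> 0) at_top"
    "((\<lambda>t::real. (t + 1) powr (2 * \<alpha>) / t) \<longlongrightarrow> 0) at_top"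
    using a by real_asymp+
  then have "((\<lambda>t. \<beta> / ((1 - 2 * \<alpha>) * (1 - \<alpha>)) * ((t + 1) / t) +
      \<beta> / (1 - \<alpha>) * ((t + 1) powr \<alpha> / t) - 2 * \<beta> / (1 - 2 * \<alpha>) * ((t + 1) powr (2 * \<alpha>) / t)) \<longlongrightarrow>
      \<beta> / ((1 - 2 * \<alpha>) * (1 - \<alpha>)) * 1 + \<beta> / (1 - \<alpha>) * 0 - 2 * \<beta> / (1 - 2 * \<alpha>) * 0) at_top"
    by (intro tendsto_intros)
  then show ?thesis
    by (simp only: var_fn_def divide_lincomb mult_1_right mult_zero_right add_0_right diff_0_right)
qed

lemma var_fn_tendsto_supercritical:
  assumes a: "1 / 2 < \<alpha>"
  shows "((\<lambda>t. var_fn \<alpha> \<beta> t / t powr (2 * \<alpha>)) \<longlongrightarrow> 2 * \<beta> / (2 * \<alpha> - 1)) at_top"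
proof -
  have "((\<lambda>t::real. (t + 1) / t powr (2 * \<alpha>)) \<longlongrightarrow> 0) at_top"
    "((\<lambda>t::real. (t + 1) powr \<alpha> / t powr (2 * \<alpha>)) \<longlongrightarrow> 0) at_top"
    "((\<lambda>t::real. (t + 1) powr (2 * \<alpha>) / t powr (2 * \<alpha>)) \<longlongrightarrow> 1) at_top"
    using a by real_asymp+
  then have "((\<lambda>t. \<beta> / ((1 - 2 * \<alpha>) * (1 - \<alpha>)) * ((t + 1) / t powr (2 * \<alpha>)) +
      \<beta> / (1 - \<alpha>) * ((t + 1) powr \<alpha> / t powr (2 * \<alpha>))
      - 2 * \<beta> / (1 - 2 * \<alpha>) * ((t + 1) powr (2 * \<alpha>) / t powr (2 * \<alpha>))) \<longlongrightarrow>
      \<beta> / ((1 - 2 * \<alpha>) * (1 - \<alpha>)) * 0 + \<beta> / (1 - \<alpha>) * 0 - 2 * \<beta> / (1 - 2 * \<alpha>) * 1) at_top"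
    by (intro tendsto_intros)
  also have "\<beta> / ((1 - 2 * \<alpha>) * (1 - \<alpha>)) * 0 + \<beta> / (1 - \<alpha>) * 0 - 2 * \<beta> / (1 - 2 * \<alpha>) * 1 =
      2 * \<beta> / (2 * \<alpha> - 1)"
    using a by (simp add: divide_simps) (simp add: algebra_simps)
  finally show ?thesis
    by (simp only: var_fn_def divide_lincomb)
qed

section \<open>The compensator identity\<close>

lemma measurable_nat_ge:
  fixes f :: "'a \<Rightarrow> nat"
  assumes "\<And>n. 0 < n \<Longrightarrow> {x \<in> space M. n \<le> f x} \<in> sets M"
  shows "f \<in> measurable M (count_space UNIV)"
proof -
  have ge: "{x \<in> space M. n \<le> f x} \<in> sets M" for n
    using assms[of n] by (cases "n = 0") auto
  have "f -` {n} \<inter> space M = {x \<in> space M. n \<le> f x} - {x \<in> space M. Suc n \<le> f x}" for n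
    by auto
  then show ?thesis
    using ge by (simp add: measurable_count_space_eq2_countable)
qed

lemma of_nat_mult_ennreal: "of_nat n * ennreal x = ennreal (real n * x)"
  by (simp add: ennreal_of_nat_eq_real_of_nat ennreal_mult')

locale ratio_intensity_process = prob_space M for M :: "'a measure" +
  fixes N :: "real \<Rightarrow> 'a \<Rightarrow> nat" and \<alpha> \<beta> :: real
  assumes \<alpha>_pos: "0 < \<alpha>" and \<beta>_pos: "0 < \<beta>"
    and point_process: "simple_point_process M N"
    and intensity: "has_intensity M (natural_filtration M N) N
      (\<lambda>t \<omega>. \<beta> + \<alpha> * (left_limit (\<lambda>s. real (N s \<omega>)) t / (t + 1)))"
begin

lemma measurable_N [measurable]: "N t \<in> measurable M (count_space UNIV)"
  using point_process unfolding simple_point_process_def by blast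

lemma
  assumes "\<omega> \<in> space M"
  shows path_mono: "mono (\<lambda>t. N t \<omega>)"
    and path_eq_0: "t \<le> 0 \<Longrightarrow> N t \<omega> = 0"
    and path_continuous: "continuous (at_right t) (\<lambda>s. real (N s \<omega>))"
  using point_process assms unfolding simple_point_process_def by auto

lemma AE_unit_jumps: "AE \<omega> in M. \<forall>t>0. N t \<omega> \<le> left_count (\<lambda>s. N s \<omega>) t + 1"
proof -
  have "AE \<omega> in M. \<forall>t>0. real (N t \<omega>) - left_limit (\<lambda>s. real (N s \<omega>)) t \<le> 1"
    using point_process unfolding simple_point_process_def by blast
  then show ?thesis
    using AE_space
  proof (eventually_elim, safe)
    fix \<omega> t
    assume *: "\<forall>t>0. real (N t \<omega>) - left_limit (\<lambda>s. real (N s \<omega>)) t \<le> 1" "\<omega> \<in> space M" "0 < (t::real)"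
    then show "N t \<omega> \<le> left_count (\<lambda>s. N s \<omega>) t + 1"
      using left_limit_eq_left_count[OF path_mono[OF *(2)], of t] by fastforce
  qed
qed

section \<open>Predictability of the left count and joint measurability\<close>

abbreviation F :: "real \<Rightarrow> 'a measure" where "F \<equiv> natural_filtration M N"

abbreviation P :: "(real \<times> 'a) measure" where "P \<equiv> predictable_sigma M F"

lemma space_F: "space (F t) = space M"
  unfolding natural_filtration_def by (rule space_measure_of) auto

lemma sets_F_ge: "0 \<le> t \<Longrightarrow> {\<omega> \<in> space M. n \<le> N t \<omega>} \<in> sets (F t)"
proof -
  assume t: "0 \<le> t"
  have "{\<omega> \<in> space M. n \<le> N t \<omega>} = N t -` {n..} \<inter> space M" by auto
  then show ?thesis
    unfolding natural_filtration_def using t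
    by (subst sets_measure_of) (auto intro!: sigma_sets.Basic)
qed

lemma predictable_generators_Pow:
  "{{a<..b} \<times> A | a b A. 0 \<le> a \<and> a \<le> b \<and> A \<in> sets (F a)} \<subseteq> Pow ({0<..} \<times> space M)"
  using sets.sets_into_space[of _ "F _"] by (force simp: space_F)

lemma space_P: "space P = {0<..} \<times> space M"
  unfolding predictable_sigma_def using predictable_generators_Pow by (rule space_measure_of)

lemma sets_P_Ioc: "0 \<le> a \<Longrightarrow> a \<le> b \<Longrightarrow> A \<in> sets (F a) \<Longrightarrow> {a<..b} \<times> A \<in> sets P"
  unfolding predictable_sigma_def sets_measure_of[OF predictable_generators_Pow]
  by (rule sigma_sets.Basic) auto

lemma sets_P_Ioi:
  assumes "0 \<le> a" "A \<in> sets (F a)"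
  shows "{a<..} \<times> A \<in> sets P"
proof -
  have "{a<..} \<times> A = (\<Union>m::nat. {a<..a + real m} \<times> A)"
  proof (safe; simp)
    fix s assume "a < s"
    then show "\<exists>m. s \<le> a + real m"
      using real_arch_simple[of "s - a"] by (auto simp: algebra_simps)
  qed
  also have "\<dots> \<in> sets P"
    using assms by (intro sets.countable_UN) (auto intro: sets_P_Ioc)
  finally show ?thesis .
qed

text \<open>A level is reached before time \<open>s\<close> iff it is reached at some rational
  \<open>q < s\<close>. Each such \<open>q\<close> contributes a half line after \<open>q\<close>
  times an event known at \<open>q\<close>, and this makes every function of the left count an
  admissible integrand.\<close>

lemma measurable_left_count_P:
  "(\<lambda>p. left_count (\<lambda>r. N r (snd p)) (fst p)) \<in> measurable P (count_space UNIV)"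
proof (rule measurable_nat_ge)
  fix n :: nat assume n: "0 < n"
  have "{p \<in> space P. n \<le> left_count (\<lambda>r. N r (snd p)) (fst p)} =
        (\<Union>q\<in>\<rat> \<inter> {0..}. {q<..} \<times> {\<omega> \<in> space M. n \<le> N q \<omega>})"
  proof -
    have "n \<le> left_count (\<lambda>r. N r \<omega>) s \<longleftrightarrow> (\<exists>q\<in>\<rat>. 0 \<le> q \<and> q < s \<and> n \<le> N q \<omega>)"
      if "\<omega> \<in> space M" for s \<omega>
      using that by (intro left_count_pos_iff path_mono path_eq_0 n)
    then show ?thesis by (fastforce simp: space_P)
  qed
  also have "\<dots> \<in> sets P"
    by (intro sets.countable_UN'' sets_P_Ioi sets_F_ge) (auto intro: countable_rat countable_Int1)
  finally show "{p \<in> space P. n \<le> left_count (\<lambda>r. N r (snd p)) (fst p)} \<in> sets P" .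
qed

lemma measurable_N_pair [measurable]:
  "(\<lambda>p. N (fst p) (snd p)) \<in> measurable (borel \<Otimes>\<^sub>M M) (count_space UNIV)"
proof (rule measurable_nat_ge)
  fix n :: nat
  have "{p \<in> space (borel \<Otimes>\<^sub>M M). n \<le> N (fst p) (snd p)} =
        space (borel \<Otimes>\<^sub>M M) - (\<Union>q\<in>\<rat>. {..<q} \<times> {\<omega> \<in> space M. N q \<omega> < n})"
  proof -
    have "\<not> n \<le> N s \<omega> \<longleftrightarrow> (\<exists>q\<in>\<rat>. s < q \<and> N q \<omega> < n)" if "\<omega> \<in> space M" for s \<omega>
      using less_iff_rat_right[OF path_mono path_continuous] that by (simp add: not_le)
    then show ?thesis by (fastforce simp: space_pair_measure)
  qed
  also have "\<dots> \<in> sets (borel \<Otimes>\<^sub>M M)"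
    by (intro sets.Diff sets.countable_UN'' pair_measureI countable_rat) auto
  finally show "{p \<in> space (borel \<Otimes>\<^sub>M M). n \<le> N (fst p) (snd p)} \<in> sets (borel \<Otimes>\<^sub>M M)" .
qed

text \<open>A monotone path has countably many discontinuities, a Lebesgue null set. This replaces
  the left limit by the current value in the integral of the intensity.\<close>

lemma AE_left_count_eq:
  assumes "\<omega> \<in> space M"
  shows "AE s in lborel. left_count (\<lambda>r. N r \<omega>) s = N s \<omega>"
proof -
  let ?D = "{s. \<not> continuous (at s) (\<lambda>r. real (N r \<omega>))}"
  have "countable ?D"
    using path_mono[OF assms]
    by (intro mono_ctble_discont) (auto simp: mono_def)
  then have "AE s in lborel. s \<notin> ?D"
    by (intro AE_not_in countable_imp_null_set_lborel)
  then show ?thesis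
  proof eventually_elim
    fix s assume "s \<notin> ?D"
    then have "((\<lambda>r. real (N r \<omega>)) \<longlongrightarrow> real (N s \<omega>)) (at s)"
      by (simp add: continuous_within)
    then have "((\<lambda>r. real (N r \<omega>)) \<longlongrightarrow> real (N s \<omega>)) (at_left s)"
      by (rule tendsto_within_subset) auto
    then have "left_limit (\<lambda>r. real (N r \<omega>)) s = real (N s \<omega>)"
      unfolding left_limit_def by (intro tendsto_Lim) auto
    then show "left_count (\<lambda>r. N r \<omega>) s = N s \<omega>"
      using left_limit_eq_left_count[OF path_mono[OF assms], of s] by simp
  qed
qed

text \<open>Every integral here takes values in [0, infinity], so the identity is available before
  any moment is known to be finite and can be used to prove finiteness.\<close>

theorem nn_integral_compensator:
  fixes g :: "nat \<Rightarrow> ennreal"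
  assumes t: "0 \<le> t"
  shows "(\<integral>\<^sup>+ \<omega>. (\<Sum>k<N t \<omega>. g k) \<partial>M) =
    (\<integral>\<^sup>+ s. indicator {0..t} s *
       (\<integral>\<^sup>+ \<omega>. g (N s \<omega>) * ennreal (\<beta> + \<alpha> * (real (N s \<omega>) / (s + 1))) \<partial>M) \<partial>lborel)"
proof -
  define C where "C p = indicator ({0<..t} \<times> space M) p * g (left_count (\<lambda>r. N r (snd p)) (fst p))"
    for p :: "real \<times> 'a"
  \<comment> \<open>The base of a generating rectangle must be known at its left endpoint, here time
    0.\<close>
  have "space M \<in> sets (F 0)"
    using sets.top[of "F 0"] by (simp add: space_F)
  then have [measurable]: "{0<..t} \<times> space M \<in> sets P"
    using t by (intro sets_P_Ioc) auto
  have "C \<in> borel_measurable P"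
    unfolding C_def
    using measurable_compose[OF measurable_left_count_P, of g borel] by simp
  then have *: "(\<integral>\<^sup>+ \<omega>. (\<integral>\<^sup>+ s\<in>{0<..}. C (s, \<omega>) \<partial>interval_measure (\<lambda>t. real (N t \<omega>))) \<partial>M) =
      (\<integral>\<^sup>+ \<omega>. (\<integral>\<^sup>+ s\<in>{0<..}. C (s, \<omega>) *
         ennreal (\<beta> + \<alpha> * (left_limit (\<lambda>s. real (N s \<omega>)) s / (s + 1))) \<partial>lborel) \<partial>M)"
    using intensity unfolding has_intensity_def by blast
  have "(\<integral>\<^sup>+ \<omega>. (\<Sum>k<N t \<omega>. g k) \<partial>M) =
    (\<integral>\<^sup>+ \<omega>. (\<integral>\<^sup>+ s\<in>{0<..}. C (s, \<omega>) \<partial>interval_measure (\<lambda>t. real (N t \<omega>))) \<partial>M)"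
    using AE_unit_jumps AE_space
  proof (intro nn_integral_cong_AE, eventually_elim)
    fix \<omega> assume jump: "\<forall>t>0. N t \<omega> \<le> left_count (\<lambda>s. N s \<omega>) t + 1" and \<omega>: "\<omega> \<in> space M"
    have "(\<integral>\<^sup>+ s\<in>{0<..}. C (s, \<omega>) \<partial>interval_measure (\<lambda>t. real (N t \<omega>))) =
      (\<integral>\<^sup>+ s. indicator {0<..t} s * g (left_count (\<lambda>s. N s \<omega>) s)
        \<partial>interval_measure (\<lambda>t. real (N t \<omega>)))"
      using \<omega> by (intro nn_integral_cong) (auto simp: C_def indicator_def)
    also have "\<dots> = (\<Sum>k<N t \<omega>. g k)"
      using nn_integral_left_count[OF path_mono[OF \<omega>] path_eq_0[OF \<omega>] path_continuous[OF \<omega>] _ t]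
        jump by blast
    finally show "(\<Sum>k<N t \<omega>. g k) =
      (\<integral>\<^sup>+ s\<in>{0<..}. C (s, \<omega>) \<partial>interval_measure (\<lambda>t. real (N t \<omega>)))" ..
  qed
  also note *
  also have "(\<integral>\<^sup>+ \<omega>. (\<integral>\<^sup>+ s\<in>{0<..}. C (s, \<omega>) *
         ennreal (\<beta> + \<alpha> * (left_limit (\<lambda>s. real (N s \<omega>)) s / (s + 1))) \<partial>lborel) \<partial>M) =
    (\<integral>\<^sup>+ \<omega>. (\<integral>\<^sup>+ s. indicator {0..t} s *
       (g (N s \<omega>) * ennreal (\<beta> + \<alpha> * (real (N s \<omega>) / (s + 1)))) \<partial>lborel) \<partial>M)"
  proof (rule nn_integral_cong)
    fix \<omega> assume \<omega>: "\<omega> \<in> space M"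
    \<comment> \<open>The intensity identity integrates over positive times, the claim over
      \<open>{0..t}\<close>; the extra point is null.\<close>
    have "AE s in lborel. s \<noteq> (0::real)"
      by (rule AE_lborel_singleton)
    then show "(\<integral>\<^sup>+ s\<in>{0<..}. C (s, \<omega>) *
         ennreal (\<beta> + \<alpha> * (left_limit (\<lambda>s. real (N s \<omega>)) s / (s + 1))) \<partial>lborel) =
      (\<integral>\<^sup>+ s. indicator {0..t} s *
       (g (N s \<omega>) * ennreal (\<beta> + \<alpha> * (real (N s \<omega>) / (s + 1)))) \<partial>lborel)"
      using AE_left_count_eq[OF \<omega>]
    proof (intro nn_integral_cong_AE, eventually_elim)
      fix s :: real assume "s \<noteq> 0" "left_count (\<lambda>r. N r \<omega>) s = N s \<omega>"
      then show "C (s, \<omega>) * ennreal (\<beta> + \<alpha> * (left_limit (\<lambda>s. real (N s \<omega>)) s / (s + 1))) *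
          indicator {0<..} s =
        indicator {0..t} s * (g (N s \<omega>) * ennreal (\<beta> + \<alpha> * (real (N s \<omega>) / (s + 1))))"
        using \<omega> left_limit_eq_left_count[OF path_mono[OF \<omega>], of s]
        by (auto simp: C_def indicator_def)
    qed
  qed
  also have "\<dots> = (\<integral>\<^sup>+ s. (\<integral>\<^sup>+ \<omega>. indicator {0..t} s *
       (g (N s \<omega>) * ennreal (\<beta> + \<alpha> * (real (N s \<omega>) / (s + 1)))) \<partial>M) \<partial>lborel)"
  proof -
    interpret pair_sigma_finite lborel M ..
    have 1: "(\<lambda>p. g (N (fst p) (snd p))) \<in> borel_measurable (lborel \<Otimes>\<^sub>M M)"
      using measurable_compose[OF measurable_N_pair, of g borel] by simp
    have 2: "(\<lambda>p. real (N (fst p) (snd p))) \<in> borel_measurable (lborel \<Otimes>\<^sub>M M)"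
      using measurable_compose[OF measurable_N_pair, of real borel] by simp
    show ?thesis
      using 1 2 by (intro Fubini') (simp add: split_beta')
  qed
  also have "\<dots> = (\<integral>\<^sup>+ s. indicator {0..t} s *
       (\<integral>\<^sup>+ \<omega>. g (N s \<omega>) * ennreal (\<beta> + \<alpha> * (real (N s \<omega>) / (s + 1))) \<partial>M) \<partial>lborel)"
    by (intro nn_integral_cong) (auto simp: indicator_def)
  finally show ?thesis .
qed

section \<open>Moments\<close>

text \<open>Monotonicity in time is what makes the moment functions integrable on bounded
  intervals.\<close>

lemma expectation_mono_path:
  assumes "s \<le> t" "mono g" "\<And>t. integrable M (\<lambda>\<omega>. g (N t \<omega>) :: real)"
  shows "expectation (\<lambda>\<omega>. g (N s \<omega>)) \<le> expectation (\<lambda>\<omega>. g (N t \<omega>))"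
  using assms by (intro integral_mono) (auto intro: monoD[OF path_mono] monoD[of g])

lemma sum_odd_truncated:
  "(\<Sum>k<m. of_nat (if k < n then 2 * k + 1 else 0)) = (of_nat ((min m n)\<^sup>2) :: ennreal)"
proof -
  have "(\<Sum>k<m. if k < n then 2 * k + 1 else 0) = (min m n)\<^sup>2"
  proof (induction m)
    case (Suc m)
    then show ?case
      by (cases "m < n") (auto simp: min_absorb1 min_absorb2 power2_eq_square)
  qed simp
  then show ?thesis by (simp only: flip: of_nat_sum)
qed

text \<open>The cutoff supplies the crude bound \<open>n\<^sup>2\<close> that Gronwall requires,
  while the resulting estimate is free of \<open>n\<close>.\<close>

lemma truncated_second_moment_bound:
  assumes t: "0 \<le> t"
  shows "expectation (\<lambda>\<omega>. real ((min (N t \<omega>) n)\<^sup>2)) \<le> 2 * exp (2 * (3 * (\<alpha> + \<beta>)) * t)"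
proof -
  \<comment> \<open>Since k <= k^2 for natural numbers, (2k + 1)(\<beta> + \<alpha> k) is at most (3
    \<alpha> + 2 \<beta>) k^2 + \<beta>, hence at most K (1 + k^2).\<close>
  define K where "K = 3 * (\<alpha> + \<beta>)"
  define v where "v t = expectation (\<lambda>\<omega>. real ((min (N t \<omega>) n)\<^sup>2))" for t
  have K: "0 < K" using \<alpha>_pos \<beta>_pos by (simp add: K_def)
  have le_n: "real ((min m n)\<^sup>2) \<le> real (n\<^sup>2)" for m
    by (simp only: of_nat_le_iff) (simp add: power_mono)
  have int: "integrable M (\<lambda>\<omega>. real ((min (N t \<omega>) n)\<^sup>2))" for t
    using le_n by (intro integrable_const_bound[where B = "real (n\<^sup>2)"]) auto
  have v0: "0 \<le> v t" for t
    unfolding v_def by (rule integral_nonneg_AE) auto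
  have vn: "v t \<le> real (n\<^sup>2)" for t
    unfolding v_def using integral_mono[OF int integrable_const le_n] by (simp add: prob_space)
  have "mono v"
    unfolding v_def
    by (intro monoI expectation_mono_path[where g = "\<lambda>m. real ((min m n)\<^sup>2)"] int)
      (auto intro!: power_mono simp: mono_def min_def)
  have gn: "ennreal (v t) = (\<integral>\<^sup>+ \<omega>. (\<Sum>k<N t \<omega>. of_nat (if k < n then 2 * k + 1 else 0)) \<partial>M)" for t
    unfolding v_def sum_odd_truncated
    using nn_integral_eq_integral[OF int] by (simp add: ennreal_of_nat_eq_real_of_nat)
  have gK: "of_nat (if k < n then 2 * k + 1 else 0) * ennreal (\<beta> + \<alpha> * (real k / (s + 1)))
      \<le> ennreal (K * (1 + real ((min k n)\<^sup>2)))" if s: "0 \<le> s" for k and s :: real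
  proof (cases "k < n")
    case True
    have "real k / (s + 1) \<le> real k / 1" using s by (intro divide_left_mono) auto
    then have "\<beta> + \<alpha> * (real k / (s + 1)) \<le> \<beta> + \<alpha> * real k"
      using \<alpha>_pos by (intro add_left_mono mult_left_mono) auto
    then have "real (2 * k + 1) * (\<beta> + \<alpha> * (real k / (s + 1))) \<le> real (2 * k + 1) * (\<beta> + \<alpha> * real k)"
      by (intro mult_left_mono) auto
    also have "\<dots> \<le> K * (1 + real (k\<^sup>2))"
    proof -
      have "real k \<le> real (k\<^sup>2)" by (simp only: of_nat_le_iff) (simp add: power2_eq_square)
      then have "\<alpha> * real k \<le> \<alpha> * real (k\<^sup>2)" "\<beta> * real k \<le> \<beta> * real (k\<^sup>2)"
        using \<alpha>_pos \<beta>_pos by simp_all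
      moreover have "0 \<le> \<beta> * real (k\<^sup>2)" using \<beta>_pos by simp
      moreover have "real (2 * k + 1) * (\<beta> + \<alpha> * real k) =
          2 * (\<beta> * real k) + 2 * (\<alpha> * real (k\<^sup>2)) + \<beta> + \<alpha> * real k"
        by (simp add: algebra_simps power2_eq_square)
      moreover have "K * (1 + real (k\<^sup>2)) =
          3 * \<alpha> + 3 * \<beta> + 3 * (\<alpha> * real (k\<^sup>2)) + 3 * (\<beta> * real (k\<^sup>2))"
        by (simp add: K_def algebra_simps)
      ultimately show ?thesis
        using \<alpha>_pos \<beta>_pos by linarith
    qed
    finally show ?thesis
      using True by (simp only: of_nat_mult_ennreal if_True min_absorb1 less_imp_le ennreal_leI)
  qed simp
  have ineq: "v t \<le> integral {0..t} (\<lambda>s. K * (1 + v s))"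
    and integrable: "(\<lambda>s. K * (1 + v s)) integrable_on {0..t}" if t: "0 \<le> t" for t
  proof -
    have "ennreal (v t) \<le> (\<integral>\<^sup>+ s. indicator {0..t} s * ennreal (K * (1 + v s)) \<partial>lborel)"
      unfolding gn nn_integral_compensator[OF t]
    proof (rule nn_integral_mono)
      fix s :: real
      have "(\<integral>\<^sup>+ \<omega>. of_nat (if N s \<omega> < n then 2 * N s \<omega> + 1 else 0) *
            ennreal (\<beta> + \<alpha> * (real (N s \<omega>) / (s + 1))) \<partial>M)
          \<le> (\<integral>\<^sup>+ \<omega>. ennreal (K * (1 + real ((min (N s \<omega>) n)\<^sup>2))) \<partial>M)" if "0 \<le> s"
        using gK[OF that] by (intro nn_integral_mono)
      also have "\<dots> = ennreal (K * (1 + v s))"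
        using K int by (subst nn_integral_eq_integral) (auto simp: v_def prob_space)
      finally show "indicator {0..t} s * (\<integral>\<^sup>+ \<omega>. of_nat (if N s \<omega> < n then 2 * N s \<omega> + 1 else 0) *
            ennreal (\<beta> + \<alpha> * (real (N s \<omega>) / (s + 1))) \<partial>M)
          \<le> indicator {0..t} s * ennreal (K * (1 + v s))"
        by (auto simp: indicator_def)
    qed
    moreover show integrable: "(\<lambda>s. K * (1 + v s)) integrable_on {0..t}"
      using \<open>mono v\<close> K
      by (intro integrable_on_mono_on) (auto simp: mono_on_def mono_def)
    have "(\<integral>\<^sup>+ s. ennreal (K * (1 + v s)) * indicator {0..t} s \<partial>lborel) =
        ennreal (integral {0..t} (\<lambda>s. K * (1 + v s)))"
      using K v0 by (intro nn_integral_has_integral_lebesgue' integrable_integral integrable) auto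
    ultimately show "v t \<le> integral {0..t} (\<lambda>s. K * (1 + v s))"
      using K v0 integrable by (simp add: mult.commute integral_nonneg)
  qed
  \<comment> \<open>Adding 1 to \<open>v\<close> absorbs the constant inside the integral and gives
    Gronwall's form with \<open>c = 1\<close>.\<close>
  have "1 + v t \<le> 2 * 1 * exp (2 * K * t)"
  proof (rule gronwall_bounded[where T = t and B = "1 + real (n\<^sup>2)"])
    fix r assume r: "r \<in> {0..t}"
    show "\<exists>g. g integrable_on {0..r} \<and> (\<forall>s\<in>{0..r}. \<bar>g s\<bar> \<le> K * (1 + v s)) \<and>
        1 + v r \<le> 1 + integral {0..r} g"
      using r K v0 ineq[of r] integrable[of r]
      by (intro exI[of _ "\<lambda>s. K * (1 + v s)"]) auto
  qed (use K t vn in auto)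
  then show ?thesis unfolding v_def K_def by simp
qed

text \<open>Monotone convergence in the cutoff transfers the uniform bound; at negative times the
  count is zero.\<close>

lemma integrable_N_squared: "integrable M (\<lambda>\<omega>. (real (N t \<omega>))\<^sup>2)"
proof (cases "0 \<le> t")
  case t: True
  let ?f = "\<lambda>n \<omega>. ennreal (real ((min (N t \<omega>) n)\<^sup>2))"
  let ?B = "ennreal (2 * exp (2 * (3 * (\<alpha> + \<beta>)) * t))"
  have "(SUP n. ?f n \<omega>) = ennreal ((real (N t \<omega>))\<^sup>2)" for \<omega>
  proof (rule antisym)
    show "(SUP n. ?f n \<omega>) \<le> ennreal ((real (N t \<omega>))\<^sup>2)"
      by (intro SUP_least ennreal_leI) (auto intro!: power_mono)
    show "ennreal ((real (N t \<omega>))\<^sup>2) \<le> (SUP n. ?f n \<omega>)"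
      by (rule SUP_upper2[of "N t \<omega>"]) auto
  qed
  then have "(\<integral>\<^sup>+ \<omega>. ennreal ((real (N t \<omega>))\<^sup>2) \<partial>M) = (\<integral>\<^sup>+ \<omega>. (SUP n. ?f n \<omega>) \<partial>M)"
    by simp
  also have "\<dots> = (SUP n. integral\<^sup>N M (?f n))"
    by (intro nn_integral_monotone_convergence_SUP)
      (auto simp: incseq_def le_fun_def intro!: ennreal_leI power_mono)
  also have "\<dots> \<le> ?B"
  proof (rule SUP_least)
    fix n
    have "real ((min m n)\<^sup>2) \<le> real (n\<^sup>2)" for m
      by (simp only: of_nat_le_iff) (simp add: power_mono)
    then have "integrable M (\<lambda>\<omega>. real ((min (N t \<omega>) n)\<^sup>2))"
      by (intro integrable_const_bound[where B = "real (n\<^sup>2)"]) auto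
    then have "integral\<^sup>N M (?f n) = ennreal (expectation (\<lambda>\<omega>. real ((min (N t \<omega>) n)\<^sup>2)))"
      by (intro nn_integral_eq_integral) auto
    also have "\<dots> \<le> ?B"
      by (intro ennreal_leI truncated_second_moment_bound t)
    finally show "integral\<^sup>N M (?f n) \<le> ?B" .
  qed
  finally have "(\<integral>\<^sup>+ \<omega>. ennreal ((real (N t \<omega>))\<^sup>2) \<partial>M) < \<infinity>"
    by (rule le_less_trans) simp
  then show ?thesis
    by (intro integrableI_nonneg) auto
next
  case False
  then show ?thesis
    by (subst Bochner_Integration.integrable_cong[OF refl, of _ _ "\<lambda>_. 0"]) (auto simp: path_eq_0)
qed

lemma integrable_N: "integrable M (\<lambda>\<omega>. real (N t \<omega>))"
proof (rule Bochner_Integration.integrable_bound[OF integrable_N_squared[of t]])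
  have "real m \<le> (real m)\<^sup>2" for m
    by (cases m) (auto simp: power2_eq_square)
  then show "AE \<omega> in M. norm (real (N t \<omega>)) \<le> norm ((real (N t \<omega>))\<^sup>2)"
    by simp
qed simp

section \<open>Integral equations for the first two moments and their solution\<close>

definition m1 :: "real \<Rightarrow> real" where "m1 t = expectation (\<lambda>\<omega>. real (N t \<omega>))"

definition m2 :: "real \<Rightarrow> real" where "m2 t = expectation (\<lambda>\<omega>. (real (N t \<omega>))\<^sup>2)"

lemma
  shows m1_nonneg: "0 \<le> m1 t" and m2_nonneg: "0 \<le> m2 t"
    and mono_m1: "mono m1" and mono_m2: "mono m2"
proof -
  show "0 \<le> m1 t" "0 \<le> m2 t"
    unfolding m1_def m2_def by (auto intro: integral_nonneg_AE)
  show "mono m1"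
    unfolding m1_def
    by (intro monoI expectation_mono_path[where g = real] integrable_N) (auto simp: mono_def)
  show "mono m2"
    unfolding m2_def
    by (intro monoI expectation_mono_path[where g = "\<lambda>k. (real k)\<^sup>2"] integrable_N_squared)
      (auto simp: mono_def intro!: power_mono)
qed

lemma m1_integral_equation:
  assumes t: "0 \<le> t"
  shows "((\<lambda>s. \<beta> + \<alpha> * (m1 s / (s + 1))) has_integral m1 t) {0..t}"
proof (rule has_integral_of_nn_integral)
  have "ennreal (m1 t) = (\<integral>\<^sup>+ \<omega>. (\<Sum>k<N t \<omega>. 1) \<partial>M)"
    unfolding m1_def using nn_integral_eq_integral[OF integrable_N]
    by (simp add: ennreal_of_nat_eq_real_of_nat)
  also note nn_integral_compensator[OF t]
  also have "(\<integral>\<^sup>+ s. indicator {0..t} s *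
       (\<integral>\<^sup>+ \<omega>. 1 * ennreal (\<beta> + \<alpha> * (real (N s \<omega>) / (s + 1))) \<partial>M) \<partial>lborel) =
    (\<integral>\<^sup>+ s. indicator {0..t} s * ennreal (\<beta> + \<alpha> * (m1 s / (s + 1))) \<partial>lborel)"
  proof (rule nn_integral_cong)
    fix s :: real
    have "(\<integral>\<^sup>+ \<omega>. ennreal (\<beta> + \<alpha> * (real (N s \<omega>) / (s + 1))) \<partial>M) = ennreal (\<beta> + \<alpha> * (m1 s / (s + 1)))"
      if "0 \<le> s"
      using that \<alpha>_pos \<beta>_pos integrable_N
      by (subst nn_integral_eq_integral) (auto simp: m1_def prob_space)
    then show "indicator {0..t} s * (\<integral>\<^sup>+ \<omega>. 1 * ennreal (\<beta> + \<alpha> * (real (N s \<omega>) / (s + 1))) \<partial>M) =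
        indicator {0..t} s * ennreal (\<beta> + \<alpha> * (m1 s / (s + 1)))"
      by (auto simp: indicator_def)
  qed
  finally show "ennreal (m1 t) = \<dots>" .
  show "(\<lambda>s. \<beta> + \<alpha> * (m1 s / (s + 1))) integrable_on {0..t}"
    by (rule integrable_add[OF integrable_const_ivl
        integrable_on_mult_right[OF mono_divide_integrable_on[OF mono_m1 m1_nonneg]]])
qed (use \<alpha>_pos \<beta>_pos m1_nonneg in auto)

text \<open>The integrand is the expectation of (2N + 1)(\<beta> + \<alpha> N / (s + 1)) multiplied
  out; an affine intensity produces nothing beyond N^2.\<close>

lemma m2_integral_equation:
  assumes t: "0 \<le> t"
  shows "((\<lambda>s. \<beta> + 2 * \<beta> * m1 s + \<alpha> * (m1 s / (s + 1)) + 2 * \<alpha> * (m2 s / (s + 1)))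
    has_integral m2 t) {0..t}"
    (is "(?h has_integral _) _")
proof (rule has_integral_of_nn_integral)
  have odd: "(\<Sum>k<m. of_nat (2 * k + 1)) = (of_nat (m\<^sup>2) :: ennreal)" for m
  proof -
    have "(\<Sum>k<m. 2 * k + 1) = m\<^sup>2"
      by (induction m) (auto simp: power2_eq_square)
    then show ?thesis by (simp only: flip: of_nat_sum)
  qed
  have "ennreal (m2 t) = (\<integral>\<^sup>+ \<omega>. (\<Sum>k<N t \<omega>. of_nat (2 * k + 1)) \<partial>M)"
    unfolding m2_def odd using nn_integral_eq_integral[OF integrable_N_squared]
    by (simp add: ennreal_of_nat_eq_real_of_nat)
  also note nn_integral_compensator[OF t]
  also have "(\<integral>\<^sup>+ s. indicator {0..t} s *
       (\<integral>\<^sup>+ \<omega>. of_nat (2 * N s \<omega> + 1) * ennreal (\<beta> + \<alpha> * (real (N s \<omega>) / (s + 1))) \<partial>M) \<partial>lborel) =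
    (\<integral>\<^sup>+ s. indicator {0..t} s * ennreal (?h s) \<partial>lborel)"
  proof (rule nn_integral_cong)
    fix s :: real
    have "(\<integral>\<^sup>+ \<omega>. of_nat (2 * N s \<omega> + 1) * ennreal (\<beta> + \<alpha> * (real (N s \<omega>) / (s + 1))) \<partial>M) =
        ennreal (?h s)" if s: "0 \<le> s"
    proof -
      have "of_nat (2 * N s \<omega> + 1) * ennreal (\<beta> + \<alpha> * (real (N s \<omega>) / (s + 1))) =
        ennreal (\<beta> + 2 * \<beta> * real (N s \<omega>) + \<alpha> * (real (N s \<omega>) / (s + 1)) +
          2 * \<alpha> * ((real (N s \<omega>))\<^sup>2 / (s + 1)))" for \<omega>
      proof -
        have "real (2 * N s \<omega> + 1) * (\<beta> + \<alpha> * (real (N s \<omega>) / (s + 1))) =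
          \<beta> + 2 * \<beta> * real (N s \<omega>) + \<alpha> * (real (N s \<omega>) / (s + 1)) +
          2 * \<alpha> * ((real (N s \<omega>))\<^sup>2 / (s + 1))"
          by (simp add: algebra_simps power2_eq_square add_divide_distrib)
        then show ?thesis by (simp only: of_nat_mult_ennreal)
      qed
      then show ?thesis
        using s \<alpha>_pos \<beta>_pos integrable_N integrable_N_squared
        by (simp only:, subst nn_integral_eq_integral) (auto simp: m1_def m2_def prob_space)
    qed
    then show "indicator {0..t} s *
       (\<integral>\<^sup>+ \<omega>. of_nat (2 * N s \<omega> + 1) * ennreal (\<beta> + \<alpha> * (real (N s \<omega>) / (s + 1))) \<partial>M) =
       indicator {0..t} s * ennreal (?h s)"
      by (auto simp: indicator_def)
  qed
  finally show "ennreal (m2 t) = \<dots>" .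
  have "m1 integrable_on {0..t}"
    using mono_m1 by (intro integrable_on_mono_on) (auto simp: mono_on_def mono_def)
  then show "?h integrable_on {0..t}"
    by (intro integrable_add[OF integrable_add[OF integrable_add[OF integrable_const_ivl]]]
        integrable_on_mult_right mono_divide_integrable_on[OF mono_m1 m1_nonneg]
        mono_divide_integrable_on[OF mono_m2 m2_nonneg])
qed (use \<alpha>_pos \<beta>_pos m1_nonneg m2_nonneg in auto)

lemma m1_eq: "\<alpha> \<noteq> 1 \<Longrightarrow> 0 \<le> t \<Longrightarrow> m1 t = mean_fn \<alpha> \<beta> t"
  using linear_volterra_unique[OF m1_integral_equation mean_fn_integral_equation] by blast

lemma variance_eq_var_fn:
  assumes \<alpha>: "\<alpha> \<noteq> 1" "\<alpha> \<noteq> 1 / 2" and t: "0 \<le> t"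
  shows "variance (\<lambda>\<omega>. real (N t \<omega>)) = var_fn \<alpha> \<beta> t"
proof -
  define q where "q s = var_fn \<alpha> \<beta> s + (mean_fn \<alpha> \<beta> s)\<^sup>2" for s
  have "m2 t = q t"
  \<comment> \<open>The first moment is already identified, so its terms form the common
    inhomogeneity \<open>b\<close>, and the coefficient \<open>a\<close> is
    \<open>2 * \<alpha>\<close>.\<close>
  proof (rule linear_volterra_unique[OF _ _ t])
    fix r :: real assume r: "0 \<le> r"
    show "((\<lambda>s. (\<beta> + 2 * \<beta> * m1 s + \<alpha> * (m1 s / (s + 1))) + 2 * \<alpha> * (m2 s / (s + 1)))
        has_integral m2 r) {0..r}"
      by (rule m2_integral_equation[OF r])
    show "((\<lambda>s. (\<beta> + 2 * \<beta> * m1 s + \<alpha> * (m1 s / (s + 1))) + 2 * \<alpha> * (q s / (s + 1)))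
        has_integral q r) {0..r}"
      using second_moment_integral_equation[OF \<alpha> r, of \<beta>] unfolding q_def[symmetric]
      by (rule has_integral_eq[rotated]) (simp add: m1_eq \<alpha>)
  qed
  moreover have "variance (\<lambda>\<omega>. real (N t \<omega>)) = m2 t - (m1 t)\<^sup>2"
    unfolding m1_def m2_def by (intro variance_eq integrable_N integrable_N_squared)
  ultimately show ?thesis
    by (simp add: q_def m1_eq \<alpha> t)
qed

end

theorem proposition14:
  fixes M :: "'a measure" and N :: "real \<Rightarrow> 'a \<Rightarrow> nat" and \<alpha> \<beta> :: real
  assumes "prob_space M"
    and "\<alpha> > 0" and "\<beta> > 0" and "\<alpha> \<noteq> 1"
    and "simple_point_process M N"
    and "has_intensity M (natural_filtration M N) N
           (\<lambda>t \<omega>. \<beta> + \<alpha> * (left_limit (\<lambda>s. real (N s \<omega>)) t / (t + 1)))"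
  defines "EN \<equiv> \<lambda>t. prob_space.expectation M (\<lambda>\<omega>. real (N t \<omega>))"
    and "VarN \<equiv> \<lambda>t. prob_space.variance M (\<lambda>\<omega>. real (N t \<omega>))"
  shows "(\<forall>t\<ge>0. integrable M (\<lambda>\<omega>. real (N t \<omega>)) \<and>
            EN t = (t + 1) * (\<beta> / (1 - \<alpha>)) * (1 - (t + 1) powr (\<alpha> - 1))) \<and>
         (\<alpha> < 1 \<longrightarrow> ((\<lambda>t. EN t / t) \<longlongrightarrow> \<beta> / (1 - \<alpha>)) at_top) \<and>
         (\<alpha> > 1 \<longrightarrow> ((\<lambda>t. EN t / t powr \<alpha>) \<longlongrightarrow> \<beta> / (\<alpha> - 1)) at_top) \<and>
         (\<alpha> \<noteq> 1 / 2 \<longrightarrow>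
            (\<forall>t\<ge>0. integrable M (\<lambda>\<omega>. (real (N t \<omega>))\<^sup>2) \<and>
               VarN t = (t + 1)\<^sup>2 *
                 ((\<beta> / ((1 - 2 * \<alpha>) * (1 - \<alpha>))) / (t + 1)
                  + (\<beta> / (1 - \<alpha>)) / (t + 1) powr (2 - \<alpha>)
                  + (- (2 * \<beta> / (1 - 2 * \<alpha>))) / (t + 1) powr (2 * (1 - \<alpha>))))) \<and>
         (\<alpha> < 1 / 2 \<longrightarrow> ((\<lambda>t. VarN t / t) \<longlongrightarrow> \<beta> / ((1 - 2 * \<alpha>) * (1 - \<alpha>))) at_top) \<and>
         (\<alpha> > 1 / 2 \<longrightarrow> ((\<lambda>t. VarN t / t powr (2 * \<alpha>)) \<longlongrightarrow> 2 * \<beta> / (2 * \<alpha> - 1)) at_top)"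
proof -
  interpret prob_space M by fact
  interpret ratio_intensity_process M N \<alpha> \<beta>
    by unfold_locales fact+
  have EN: "EN t = mean_fn \<alpha> \<beta> t" if "0 \<le> t" for t
    using m1_eq[OF \<open>\<alpha> \<noteq> 1\<close> that] by (simp add: EN_def m1_def)
  have VarN: "VarN t = var_fn \<alpha> \<beta> t" if "0 \<le> t" "\<alpha> \<noteq> 1 / 2" for t
    using variance_eq_var_fn[OF \<open>\<alpha> \<noteq> 1\<close> that(2,1)] by (simp add: VarN_def)
  have mean: "mean_fn \<alpha> \<beta> t = (t + 1) * (\<beta> / (1 - \<alpha>)) * (1 - (t + 1) powr (\<alpha> - 1))"
    if "0 \<le> t" for t
  proof -
    have "(t + 1) powr (\<alpha> - 1) = (t + 1) powr \<alpha> / (t + 1)"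
      using that by (simp add: powr_diff)
    then show ?thesis
      using that by (simp add: mean_fn_def right_diff_distrib)
  qed
  have var: "var_fn \<alpha> \<beta> t = (t + 1)\<^sup>2 *
       ((\<beta> / ((1 - 2 * \<alpha>) * (1 - \<alpha>))) / (t + 1) + (\<beta> / (1 - \<alpha>)) / (t + 1) powr (2 - \<alpha>)
        + (- (2 * \<beta> / (1 - 2 * \<alpha>))) / (t + 1) powr (2 * (1 - \<alpha>)))" if "0 \<le> t" for t
  proof -
    \<comment> \<open>The remaining exponents are 2 - (2 - \<alpha>) = \<alpha> and 2 - 2(1 -
      \<alpha>) = 2\<alpha>.\<close>
    have eqs: "(t + 1)\<^sup>2 * (x / (t + 1)) = x * (t + 1)"
      "(t + 1)\<^sup>2 * (x / (t + 1) powr (2 - \<alpha>)) = x * (t + 1) powr \<alpha>"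
      "(t + 1)\<^sup>2 * (x / (t + 1) powr (2 * (1 - \<alpha>))) = x * (t + 1) powr (2 * \<alpha>)" for x
      using that by (simp_all add: powr_diff power2_eq_square right_diff_distrib powr_add[symmetric])
    show ?thesis
      unfolding var_fn_def distrib_left eqs by simp
  qed
  \<comment> \<open>The closed forms agree with the moments only for nonnegative times, which
    suffices at infinity.\<close>
  have EN_lim: "((\<lambda>t. EN t / f t) \<longlongrightarrow> l) at_top"
    if "((\<lambda>t. mean_fn \<alpha> \<beta> t / f t) \<longlongrightarrow> l) at_top" for f :: "real \<Rightarrow> real" and l
    by (rule Lim_transform_eventually[OF that])
      (auto intro!: eventually_mono[OF eventually_ge_at_top[of 0]] simp: EN)
  have VarN_lim: "((\<lambda>t. VarN t / f t) \<longlongrightarrow> l) at_top"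
    if "\<alpha> \<noteq> 1 / 2" "((\<lambda>t. var_fn \<alpha> \<beta> t / f t) \<longlongrightarrow> l) at_top" for f :: "real \<Rightarrow> real" and l
    by (rule Lim_transform_eventually[OF that(2)])
      (auto intro!: eventually_mono[OF eventually_ge_at_top[of 0]] simp: VarN[OF _ that(1)])
  show ?thesis
  proof (intro conjI impI allI)
    show "integrable M (\<lambda>\<omega>. real (N t \<omega>))" "integrable M (\<lambda>\<omega>. (real (N t \<omega>))\<^sup>2)" for t
      by (rule integrable_N integrable_N_squared)+
  qed (use EN VarN mean var mean_fn_tendsto var_fn_tendsto_subcritical var_fn_tendsto_supercritical \<open>\<alpha> > 0\<close> in
      \<open>auto intro!: EN_lim VarN_lim simp del: times_divide_eq_right times_divide_eq_left\<close>)
qed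

end
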